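(* Let $\bm C\in\mathbb S^d_{++}$, $\bm a_1,\dots,\bm a_n\in\mathbb R^d$, let $s$ be a positive integer with $s<n$, and let $$z^*:=\max_{S\subseteq[n],\,|S|=s}\log\det\Big(\bm C+\sum_{i\in S}\bm a_i\bm a_i^\top\Big).$$ Let $\hat S$ be the output of the local-search algorithm and let $\bar s:=\min\{s,n-s\}$. Then $$\log\det\Big(\bm C+\sum_{i\in\hat S}\bm a_i\bm a_i^\top\Big)\ \ge\ z^*-\min\Big\{d\log\Big(1+\frac{\bar s\,\sigma_{\max}^2}{d(1+\sigma_{\max})}\Big),\ \bar s\log(\bar s)\Big\},$$ where $\sigma_{\max}:=\max_{i\in[n]}\bm a_i^\top\bm C^{-1}\bm a_i$.
   Context: $[n]=\{1,\dots,n\}$; $\mathbb S^d_{++}$ is the set of symmetric positive-definite $d\times d$ matrices. Local-search algorithm: start with an arbitrary $\hat S\subseteq[n]$ with $|\hat S|=s$; as long as there is a pair $(i,j)\in\hat S\times([n]\setminus\hat S)$ such that replacing $\hat S$ by $(\hat S\cup\{j\})\setminus\{i\}$ strictly increases $\det(\bm C+\sum_{\ell\in\hat S}\bm a_\ell\bm a_\ell^\top)$, perform such a swap; stop and output $\hat S$ when no such pair exists. Thus the output is a set $\hat S$ with $|\hat S|=s$ such that $\det(\bm C+\sum_{\ell\in(\hat S\cup\{j\})\setminus\{i\}}\bm a_\ell\bm a_\ell^\top)\le\det(\bm C+\sum_{\ell\in\hat S}\bm a_\ell\bm a_\ell^\top)$ for all $i\in\hat S$, $j\in[n]\setminus\hat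 S$. *)

theory Defs
  imports "HOL-Analysis.Analysis"
begin

definition sym_pos_def :: "real ^ 'd ^ 'd \<Rightarrow> bool" where
  "sym_pos_def A \<longleftrightarrow> transpose A = A \<and> (\<forall>x. x \<noteq> 0 \<longrightarrow> 0 < x \<bullet> (A *v x))"

definition outer :: "real ^ 'd \<Rightarrow> real ^ 'd ^ 'd" where
  "outer v = (\<chi> i j. v $ i * v $ j)"

definition info_det :: "real ^ 'd ^ 'd \<Rightarrow> (nat \<Rightarrow> real ^ 'd) \<Rightarrow> nat set \<Rightarrow> real" where
  "info_det C a S = det (C + (\<Sum>i\<in>S. outer (a i)))"

definition opt_value :: "real ^ 'd ^ 'd \<Rightarrow> (nat \<Rightarrow> real ^ 'd) \<Rightarrow> nat \<Rightarrow> nat \<Rightarrow> real" where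
  "opt_value C a n s = Max ((\<lambda>S. ln (info_det C a S)) ` {S. S \<subseteq> {1..n} \<and> card S = s})"

definition sigma_max :: "real ^ 'd ^ 'd \<Rightarrow> (nat \<Rightarrow> real ^ 'd) \<Rightarrow> nat \<Rightarrow> real" where
  "sigma_max C a n = Max ((\<lambda>i. a i \<bullet> (matrix_inv C *v a i)) ` {1..n})"

definition improving_swap ::
  "real ^ 'd ^ 'd \<Rightarrow> (nat \<Rightarrow> real ^ 'd) \<Rightarrow> nat \<Rightarrow> nat set \<Rightarrow> nat set \<Rightarrow> bool" where
  "improving_swap C a n S T \<longleftrightarrow>
     (\<exists>i\<in>S. \<exists>j\<in>{1..n} - S. T = (S \<union> {j}) - {i} \<and> info_det C a S < info_det C a T)"

(* The algorithm is nondeterministic (initial set and choice of swap), so its outputs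
   form a set: the end points of terminated runs. *)
definition local_search_output ::
  "real ^ 'd ^ 'd \<Rightarrow> (nat \<Rightarrow> real ^ 'd) \<Rightarrow> nat \<Rightarrow> nat \<Rightarrow> nat set \<Rightarrow> bool" where
  "local_search_output C a n s S \<longleftrightarrow>
     (\<exists>S0. S0 \<subseteq> {1..n} \<and> card S0 = s \<and> (improving_swap C a n)\<^sup>*\<^sup>* S0 S) \<and>
     (\<nexists>T. improving_swap C a n S T)"

end

theory Submission
  imports Defs "Jordan_Normal_Form.Schur_Decomposition"
begin

text \<open>
  Write \<open>X = C + \<Sum>\<^bsub>i\<in>S\<^esub> a\<^sub>i a\<^sub>i\<^sup>T\<close> for the output \<open>S\<close> and \<open>r i j\<close> for the entries of the Gram matrix of the
  points \<open>a\<^sub>i\<close> with respect to \<open>X\<close> inverse. By the Weinstein--Aronszajn identity, exchanging the points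
  \<open>u\<^sub>1, \<dots>, u\<^sub>k\<close> of \<open>S\<close> for outside points \<open>v\<^sub>1, \<dots>, v\<^sub>k\<close> multiplies the determinant by \<open>det H\<close>, where \<open>H\<close> is
  a \<open>2k \<times> 2k\<close> matrix with entries \<open>\<delta> \<plusminus> r\<close>. For \<open>k = 1\<close>, local optimality reads
  \<open>(1 - r i i) (1 + r j j) + (r i j)\<^sup>2 \<le> 1\<close> for \<open>i \<in> S\<close> and \<open>j \<notin> S\<close>.

  For the first bound, AM-GM on the spectrum of \<open>X\<close> inverse times the new matrix bounds \<open>det H\<close>
  by \<open>(1 + (\<Sum> r v\<^sub>l v\<^sub>l - r u\<^sub>l u\<^sub>l) / d)\<^sup>d\<close>, and local optimality gives
  \<open>r j j - r i i \<le> r i i * r j j \<le> \<sigma> / (1 + \<sigma>) * \<sigma>\<close>.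

  For the second bound, the condition on swaps controls the mixed entries of \<open>H\<close> by its diagonal, and
  Cauchy--Schwarz controls the others. After a diagonal scaling that leaves \<open>det H\<close> unchanged and
  gives both diagonal blocks the same trace, the squared entries of \<open>H\<close> sum to at most \<open>2k\<^sup>2\<close>, so AM-GM on
  the spectrum of \<open>H\<^sup>T H\<close> yields \<open>(det H)\<^sup>2 \<le> k\<^bsup>2k\<^esup>\<close>.
\<close>

no_notation scalar_prod (infix \<open>\<bullet>\<close> 70)
no_notation vec_index (infixl \<open>$\<close> 100)
hide_const (open) Finite_Cartesian_Product.mat

section \<open>Spectral bounds on determinants\<close>

lemma sum_diag_mult_commute:
  fixes A B :: "'a::comm_semiring_0 mat"
  assumes "A \<in> carrier_mat n m" "B \<in> carrier_mat m n"
  shows "(\<Sum>i<n. (A * B) $$ (i,i)) = (\<Sum>i<m. (B * A) $$ (i,i))"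
proof -
  have "(\<Sum>i<n. (A * B) $$ (i,i)) = (\<Sum>i<n. \<Sum>j<m. A $$ (i,j) * B $$ (j,i))"
    using assms by (auto simp: scalar_prod_def atLeast0LessThan intro!: sum.cong)
  also have "\<dots> = (\<Sum>j<m. \<Sum>i<n. B $$ (j,i) * A $$ (i,j))"
    by (subst sum.swap) (simp add: mult.commute)
  also have "\<dots> = (\<Sum>i<m. (B * A) $$ (i,i))"
    using assms by (auto simp: scalar_prod_def atLeast0LessThan intro!: sum.cong)
  finally show ?thesis .
qed

text \<open>Schur triangularisation gives a similar triangular matrix with the eigenvalues, counted
  with multiplicity, on its diagonal, and similarity preserves determinant and trace. Over the
  complex numbers the characteristic polynomial always splits.\<close>

lemma complex_mat_eigenvalues:
  assumes A: "(A :: complex mat) \<in> carrier_mat n n"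
  obtains es where "length es = n" "\<And>e. e \<in> set es \<Longrightarrow> eigenvalue A e"
    "Determinant.det A = prod_list es" "(\<Sum>i<n. A $$ (i,i)) = sum_list es"
proof -
  obtain as where as: "char_poly A = (\<Prod>a\<leftarrow>as. [:- a, 1:])"
    using char_poly_factorized[OF A] by blast
  obtain B where B: "B \<in> carrier_mat n n" and ut: "upper_triangular B" and sim: "similar_mat A B"
    using schur_decomposition_exists[OF A as] by blast
  let ?es = "diag_mat B"
  have cp: "char_poly A = (\<Prod>a\<leftarrow>?es. [:- a, 1:])"
    using char_poly_similar[OF sim] char_poly_upper_triangular[OF B ut] by simp
  have "eigenvalue A e" if "e \<in> set ?es" for e
    unfolding eigenvalue_root_char_poly[OF A] cp
    using that by (auto simp: poly_prod_list prod_list_zero_iff)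
  moreover have "Determinant.det A = prod_list ?es"
    using det_similar[OF sim] det_upper_triangular[OF ut B] by simp
  moreover have "(\<Sum>i<n. A $$ (i,i)) = sum_list ?es"
  proof -
    obtain P Q where w: "similar_mat_wit A B P Q"
      using sim by (auto simp: similar_mat_def)
    note PQ = similar_mat_witD2[OF A w]
    have "(\<Sum>i<n. A $$ (i,i)) = (\<Sum>i<n. (P * (B * Q)) $$ (i,i))"
      using PQ by (simp add: assoc_mult_mat[of P n n B n Q n])
    also have "\<dots> = (\<Sum>i<n. (B * Q * P) $$ (i,i))"
      using PQ by (intro sum_diag_mult_commute) auto
    also have "B * Q * P = B"
      using PQ by (simp add: assoc_mult_mat[of B n n Q n P n])
    also have "(\<Sum>i<n. B $$ (i,i)) = sum_list ?es"
      using B by (simp add: diag_mat_def interv_sum_list_conv_sum_set_nat atLeast0LessThan)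
    finally show ?thesis .
  qed
  ultimately show ?thesis
    using that[of ?es] B by (simp add: diag_mat_def)
qed

lemma prod_list_le_mean_power:
  fixes xs :: "real list"
  assumes "\<And>x. x \<in> set xs \<Longrightarrow> 0 \<le> x"
  shows "prod_list xs \<le> (sum_list xs / length xs) ^ length xs"
proof (cases "xs = []")
  case False
  let ?n = "length xs"
  define p where "p = (\<Prod>i<?n. xs ! i)"
  have n: "0 < ?n" using False by simp
  have p0: "0 \<le> p"
    unfolding p_def using assms by (intro prod_nonneg) auto
  have "p powr (1 / ?n) \<le> (\<Sum>i<?n. xs ! i / ?n)"
    using arith_geom_mean[of "{..<?n}" "\<lambda>i. xs ! i"] assms n by (auto simp: p_def)
  also have "\<dots> = sum_list xs / ?n"
    by (simp add: sum_divide_distrib[symmetric] sum_list_sum_nth atLeast0LessThan)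
  finally have "(p powr (1 / ?n)) ^ ?n \<le> (sum_list xs / ?n) ^ ?n"
    by (intro power_mono) auto
  moreover have "(p powr (1 / ?n)) ^ ?n = p"
    using n p0 by (cases "p = 0") (simp_all add: powr_power)
  moreover have "p = prod_list xs"
    by (simp add: p_def prod.list_conv_set_nth atLeast0LessThan)
  ultimately show ?thesis by simp
qed simp

definition bilin_form :: "nat \<Rightarrow> real mat \<Rightarrow> (nat \<Rightarrow> real) \<Rightarrow> (nat \<Rightarrow> real) \<Rightarrow> real" where
  "bilin_form n A y z = (\<Sum>i<n. \<Sum>j<n. y i * A $$ (i,j) * z j)"

lemma bilin_form_commute:
  assumes "\<And>i j. i < n \<Longrightarrow> j < n \<Longrightarrow> A $$ (i,j) = A $$ (j,i)"
  shows "bilin_form n A y z = bilin_form n A z y"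
  unfolding bilin_form_def
  by (subst sum.swap) (auto intro!: sum.cong simp: assms)

text \<open>Meant for \<open>p\<close> the real or imaginary part of a complex eigenvector of
  \<open>M\<close>: the premise is then the matching part of the eigenvalue equation.\<close>

lemma bilin_form_mult:
  assumes "X \<in> carrier_mat n n" "M \<in> carrier_mat n n"
    and "\<And>l. l < n \<Longrightarrow> (\<Sum>j<n. M $$ (l,j) * p j) = c * u l + d * v l"
  shows "bilin_form n (X * M) y p = c * bilin_form n X y u + d * bilin_form n X y v"
proof -
  have "bilin_form n (X * M) y p = (\<Sum>i<n. \<Sum>j<n. \<Sum>l<n. y i * X $$ (i,l) * (M $$ (l,j) * p j))"
    unfolding bilin_form_def using assms(1,2)
    by (auto intro!: sum.cong simp: scalar_prod_def atLeast0LessThan sum_distrib_left sum_distrib_right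
        mult.assoc)
  also have "\<dots> = (\<Sum>i<n. \<Sum>l<n. y i * X $$ (i,l) * (\<Sum>j<n. M $$ (l,j) * p j))"
    unfolding sum_distrib_left by (rule sum.cong[OF refl], rule sum.swap)
  also have "\<dots> = (\<Sum>i<n. \<Sum>l<n. y i * X $$ (i,l) * (c * u l + d * v l))"
    by (auto intro!: sum.cong simp: assms(3))
  also have "\<dots> = c * bilin_form n X y u + d * bilin_form n X y v"
    by (simp only: bilin_form_def sum_distrib_left sum.distrib[symmetric] distrib_left mult_ac)
  finally show ?thesis .
qed

text \<open>\<open>M\<close> is self-adjoint and nonnegative for the inner product given by \<open>X\<close>, so its complex
  eigenvalues are real and nonnegative although \<open>M\<close> itself need not be symmetric.\<close>

locale symmetric_pencil =
  fixes n :: nat and X M :: "real mat"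
  assumes X: "X \<in> carrier_mat n n" and M: "M \<in> carrier_mat n n"
    and X_sym: "\<And>i j. i < n \<Longrightarrow> j < n \<Longrightarrow> X $$ (i,j) = X $$ (j,i)"
    and XM_sym: "\<And>i j. i < n \<Longrightarrow> j < n \<Longrightarrow> (X * M) $$ (i,j) = (X * M) $$ (j,i)"
    and X_pos: "\<And>y. \<exists>i<n. y i \<noteq> 0 \<Longrightarrow> 0 < bilin_form n X y y"
    and XM_nonneg: "\<And>y. 0 \<le> bilin_form n (X * M) y y"
begin

text \<open>Split an eigenvector into real part \<open>p\<close> and imaginary part \<open>q\<close>
  and pair \<open>M p\<close>, \<open>M q\<close> with \<open>p\<close>, \<open>q\<close> in the
  inner product of \<open>X\<close>. Symmetry of \<open>X * M\<close> leaves
  \<open>Im e * N = 0\<close>, and its nonnegativity leaves \<open>Re e * N \<ge> 0\<close>, where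
  \<open>N > 0\<close> is the squared norm of the eigenvector.\<close>

lemma eigenvalue_nonneg:
  assumes "eigenvalue (map_mat complex_of_real M) e"
  shows "Im e = 0 \<and> 0 \<le> Re e"
proof -
  let ?M = "map_mat complex_of_real M"
  obtain v where v: "v \<in> carrier_vec n" "v \<noteq> 0\<^sub>v n" "?M *\<^sub>v v = e \<cdot>\<^sub>v v"
    using assms M by (auto simp: eigenvalue_def eigenvector_def)
  define p q where "p i = Re (vec_index v i)" and "q i = Im (vec_index v i)" for i
  have ev: "(\<Sum>j<n. complex_of_real (M $$ (l,j)) * vec_index v j) = e * vec_index v l" if "l < n" for l
  proof -
    have "vec_index (?M *\<^sub>v v) l = vec_index (e \<cdot>\<^sub>v v) l" using v by simp
    then show ?thesis
      using that v(1) M by (auto simp: scalar_prod_def atLeast0LessThan)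
  qed
  have Mp: "bilin_form n (X * M) y p = Re e * bilin_form n X y p + (- Im e) * bilin_form n X y q" for y
    by (rule bilin_form_mult[OF X M]) (use arg_cong[OF ev, of _ Re] in \<open>simp add: p_def q_def\<close>)
  have Mq: "bilin_form n (X * M) y q = Im e * bilin_form n X y p + Re e * bilin_form n X y q" for y
    by (rule bilin_form_mult[OF X M]) (use arg_cong[OF ev, of _ Im] in \<open>simp add: p_def q_def\<close>)
  define N where "N = bilin_form n X p p + bilin_form n X q q"
  have "\<exists>i<n. vec_index v i \<noteq> 0"
    using v by (metis carrier_vecD eq_vecI index_zero_vec)
  then obtain i where "i < n" "p i \<noteq> 0 \<or> q i \<noteq> 0"
    by (auto simp: p_def q_def complex_eq_iff)
  moreover have "0 \<le> bilin_form n X y y" for y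
    using X_pos[of y] by (cases "\<exists>i<n. y i \<noteq> 0") (auto simp: bilin_form_def)
  ultimately have N: "0 < N"
    unfolding N_def by (metis X_pos add_nonneg_pos add_pos_nonneg)
  have c: "bilin_form n X q p = bilin_form n X p q"
    by (rule bilin_form_commute[OF X_sym])
  have "bilin_form n (X * M) q p = bilin_form n (X * M) p q"
    by (rule bilin_form_commute[OF XM_sym])
  then have "Im e * N = 0"
    unfolding Mp Mq c N_def by (simp add: algebra_simps)
  moreover have "Re e * N = bilin_form n (X * M) p p + bilin_form n (X * M) q q"
    unfolding Mp Mq c N_def by (simp add: algebra_simps)
  then have "0 \<le> Re e * N"
    using XM_nonneg by simp
  ultimately show ?thesis
    using N by (simp add: zero_le_mult_iff)
qed

text \<open>The spectrum is a list of nonnegative reals with product the determinant and sum the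
  trace; the last claim is AM-GM for that list.\<close>

lemma det_nonneg: "0 \<le> Determinant.det M"
  and diag_sum_nonneg: "0 \<le> (\<Sum>i<n. M $$ (i,i))"
  and det_le_mean_diag_power: "Determinant.det M \<le> ((\<Sum>i<n. M $$ (i,i)) / n) ^ n"
proof -
  obtain es where es: "length es = n"
      "\<And>e. e \<in> set es \<Longrightarrow> eigenvalue (map_mat complex_of_real M) e"
      "Determinant.det (map_mat complex_of_real M) = prod_list es"
      "(\<Sum>i<n. map_mat complex_of_real M $$ (i,i)) = sum_list es"
    using complex_mat_eigenvalues[of "map_mat complex_of_real M" n] M by auto
  define xs where "xs = map Re es"
  have re: "es = map complex_of_real xs"
    unfolding xs_def map_map using eigenvalue_nonneg[OF es(2)]
    by (auto intro!: map_idI[symmetric] simp: complex_eq_iff)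
  have nn: "0 \<le> x" if "x \<in> set xs" for x
    using that eigenvalue_nonneg[OF es(2)] by (auto simp: xs_def)
  have pl: "prod_list (map complex_of_real ys) = complex_of_real (prod_list ys)" for ys
    by (induction ys) auto
  have sl: "sum_list (map complex_of_real ys) = complex_of_real (sum_list ys)" for ys
    by (induction ys) auto
  have det: "Determinant.det M = prod_list xs"
    using es(3) unfolding re pl of_real_hom.hom_det by simp
  have "complex_of_real (\<Sum>i<n. M $$ (i,i)) = complex_of_real (sum_list xs)"
    using es(4) M unfolding re sl by simp
  then have tr: "(\<Sum>i<n. M $$ (i,i)) = sum_list xs"
    by (simp only: of_real_eq_iff)
  show "0 \<le> Determinant.det M"
    unfolding det using nn by (induction xs) auto
  show "0 \<le> (\<Sum>i<n. M $$ (i,i))"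
    unfolding tr using nn by (rule sum_list_nonneg)
  show "Determinant.det M \<le> ((\<Sum>i<n. M $$ (i,i)) / n) ^ n"
    unfolding det tr using prod_list_le_mean_power[of xs] nn es(1) by (simp add: xs_def)
qed

end

text \<open>The pencil bound is applied to the Gram matrix of \<open>H\<close> with the standard
  inner product: its determinant is the square of that of \<open>H\<close>, and its trace is the sum
  of the squared entries of \<open>H\<close>.\<close>

lemma det_square_le_frobenius:
  fixes H :: "real mat"
  assumes H: "H \<in> carrier_mat n n"
  shows "(Determinant.det H)\<^sup>2 \<le> ((\<Sum>i<n. \<Sum>j<n. (H $$ (i,j))\<^sup>2) / n) ^ n"
proof -
  let ?M = "transpose_mat H * H"
  have HH: "?M $$ (i,j) = (\<Sum>l<n. H $$ (l,i) * H $$ (l,j))" if "i < n" "j < n" for i j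
    using that H by (auto simp: scalar_prod_def atLeast0LessThan intro!: sum.cong)
  interpret symmetric_pencil n "1\<^sub>m n" ?M
  proof
    fix y :: "nat \<Rightarrow> real"
    have "bilin_form n (1\<^sub>m n) y y = (\<Sum>i<n. (y i)\<^sup>2)"
      unfolding bilin_form_def
      by (auto intro!: sum.cong simp: power2_eq_square if_distrib if_distribR cong: if_cong)
    then show "0 < bilin_form n (1\<^sub>m n) y y" if "\<exists>i<n. y i \<noteq> 0"
      using that by (auto intro!: sum_pos2)
    have "bilin_form n ?M y y = (\<Sum>i<n. \<Sum>j<n. \<Sum>l<n. (y i * H $$ (l,i)) * (y j * H $$ (l,j)))"
      unfolding bilin_form_def
      by (auto intro!: sum.cong simp: HH sum_distrib_left sum_distrib_right algebra_simps)
    also have "\<dots> = (\<Sum>i<n. \<Sum>l<n. \<Sum>j<n. (y i * H $$ (l,i)) * (y j * H $$ (l,j)))"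
      by (rule sum.cong[OF refl], rule sum.swap)
    also have "\<dots> = (\<Sum>l<n. \<Sum>i<n. \<Sum>j<n. (y i * H $$ (l,i)) * (y j * H $$ (l,j)))"
      by (rule sum.swap)
    also have "\<dots> = (\<Sum>l<n. (\<Sum>i<n. y i * H $$ (l,i))\<^sup>2)"
      by (simp add: power2_eq_square sum_product)
    finally have "0 \<le> bilin_form n ?M y y" by (simp add: sum_nonneg)
    then show "0 \<le> bilin_form n (1\<^sub>m n * ?M) y y" using H by simp
  next
    fix i j assume "i < n" "j < n"
    then show "(1\<^sub>m n * ?M) $$ (i,j) = (1\<^sub>m n * ?M) $$ (j,i)"
      using H HH by (simp add: mult.commute)
  qed (use H in auto)
  have "Determinant.det ?M = (Determinant.det H)\<^sup>2"
    using H by (simp add: det_mult[of _ n] det_transpose power2_eq_square)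
  moreover have "(\<Sum>i<n. ?M $$ (i,i)) = (\<Sum>i<n. \<Sum>j<n. (H $$ (i,j))\<^sup>2)"
    by (subst sum.swap, intro sum.cong refl) (simp add: HH power2_eq_square)
  ultimately show ?thesis
    using det_le_mean_diag_power by simp
qed

section \<open>Determinants of low-rank updates\<close>

text \<open>The determinant of one block matrix \<open>?N\<close> is computed in two ways:
  multiplying by the unipotent \<open>?R\<close> on the right, or \<open>?L\<close> on the left,
  clears the lower left block and leaves \<open>X + B * C\<close> or the small matrix on the
  diagonal.\<close>

lemma det_add_mult:
  fixes X Y B C :: "'a::idom mat"
  assumes X: "X \<in> carrier_mat d d" and Y: "Y \<in> carrier_mat d d" and YX: "Y * X = 1\<^sub>m d"
    and B: "B \<in> carrier_mat d m" and C: "C \<in> carrier_mat m d"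
  shows "Determinant.det (X + B * C) = Determinant.det X * Determinant.det (1\<^sub>m m + C * (Y * B))"
proof -
  let ?N = "four_block_mat X (- B) C (1\<^sub>m m)"
  let ?R = "four_block_mat (1\<^sub>m d) (0\<^sub>m d m) (- C) (1\<^sub>m m)"
  let ?L = "four_block_mat (1\<^sub>m d) (0\<^sub>m d m) (- (C * Y)) (1\<^sub>m m)"
  have N: "?N \<in> carrier_mat (d + m) (d + m)" and R: "?R \<in> carrier_mat (d + m) (d + m)"
    and L: "?L \<in> carrier_mat (d + m) (d + m)"
    using assms by auto
  have "?N * ?R = four_block_mat (X * 1\<^sub>m d + (- B) * (- C)) (X * 0\<^sub>m d m + (- B) * 1\<^sub>m m)
      (C * 1\<^sub>m d + 1\<^sub>m m * (- C)) (C * 0\<^sub>m d m + 1\<^sub>m m * 1\<^sub>m m)"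
    using assms by (intro mult_four_block_mat) auto
  also have "\<dots> = four_block_mat (X + B * C) (- B) (0\<^sub>m m d) (1\<^sub>m m)"
    using assms by (intro cong_four_block_mat) (auto simp: minus_r_inv_mat add_uminus_minus_mat)
  finally have "Determinant.det (?N * ?R) = Determinant.det (X + B * C)"
    using assms by (simp add: det_four_block_mat_lower_left_zero[of _ d _ m])
  moreover have "Determinant.det ?R = 1" "Determinant.det ?L = 1"
    using assms by (simp_all add: det_four_block_mat_upper_right_zero[of _ d _ m])
  moreover have "?L * ?N = four_block_mat (1\<^sub>m d * X + 0\<^sub>m d m * C) (1\<^sub>m d * (- B) + 0\<^sub>m d m * 1\<^sub>m m)
      (- (C * Y) * X + 1\<^sub>m m * C) (- (C * Y) * (- B) + 1\<^sub>m m * 1\<^sub>m m)"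
    using assms by (intro mult_four_block_mat) auto
  moreover have "\<dots> = four_block_mat X (- B) (0\<^sub>m m d) (1\<^sub>m m + C * (Y * B))"
    using assms
    by (intro cong_four_block_mat)
      (auto simp: assoc_mult_mat[of C m d Y d] uminus_l_inv_mat comm_add_mat[of _ m m])
  ultimately show ?thesis
    using assms N R L det_mult[OF N R] det_mult[OF L N]
    by (simp add: det_four_block_mat_lower_left_zero[of _ d _ m])
qed

lemma matrix_inv_mult:
  assumes "invertible A"
  shows "A ** matrix_inv A = Finite_Cartesian_Product.mat 1"
    and "matrix_inv A ** A = Finite_Cartesian_Product.mat 1"
  using someI_ex[OF assms[unfolded invertible_def]] by (simp_all add: matrix_inv_def)

section \<open>Transfer between matrices over a finite index type and matrices indexed by
  naturals\<close>

definition idx :: "nat \<Rightarrow> 'd::finite" where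
  "idx = (SOME f. bij_betw f {0..<CARD('d)} UNIV)"

lemma bij_idx: "bij_betw (idx :: nat \<Rightarrow> 'd::finite) {0..<CARD('d)} UNIV"
  unfolding idx_def using ex_bij_betw_nat_finite[OF finite_class.finite_UNIV]
  by (rule someI_ex)

lemma sum_idx: "(\<Sum>i<CARD('d). f (idx i :: 'd::finite)) = (\<Sum>x\<in>UNIV. f x)"
  using sum.reindex_bij_betw[OF bij_idx, of f] by (simp add: atLeast0LessThan)

definition mat_of_vec :: "'a ^ 'd ^ 'd \<Rightarrow> 'a mat" where
  "mat_of_vec A = mat CARD('d) CARD('d) (\<lambda>(i,j). A $ idx i $ idx j)"

lemma mat_of_vec_carrier [simp]: "mat_of_vec (A :: 'a ^ 'd ^ 'd) \<in> carrier_mat CARD('d) CARD('d)"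
  by (simp add: mat_of_vec_def)

lemma index_mat_of_vec [simp]:
  fixes A :: "'a ^ 'd ^ 'd"
  assumes "i < CARD('d)" "j < CARD('d)"
  shows "mat_of_vec A $$ (i,j) = A $ idx i $ idx j"
  using assms by (simp add: mat_of_vec_def)

lemma idx_eq_iff:
  assumes "i < CARD('d)" "j < CARD('d)"
  shows "(idx i :: 'd::finite) = idx j \<longleftrightarrow> i = j"
  using bij_idx[where 'd='d] assms by (auto simp: bij_betw_def inj_on_def)

lemma mat_of_vec_mult:
  fixes A B :: "'a::semiring_1 ^ 'd ^ 'd"
  shows "mat_of_vec (A ** B) = mat_of_vec A * mat_of_vec B"
  by (rule eq_matI)
    (auto simp: mat_of_vec_def scalar_prod_def matrix_matrix_mult_def atLeast0LessThan sum_idx[symmetric])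

lemma mat_of_vec_one:
  "mat_of_vec (Finite_Cartesian_Product.mat 1 :: 'a::semiring_1 ^ 'd ^ 'd) = 1\<^sub>m CARD('d)"
  by (rule eq_matI) (auto simp: mat_of_vec_def Finite_Cartesian_Product.mat_def idx_eq_iff)

text \<open>Conjugation with the enumeration \<open>idx\<close> is a sign-preserving bijection
  between the two permutation groups, so the Leibniz sums agree term by term.\<close>

lemma det_mat_of_vec:
  fixes A :: "'a::comm_ring_1 ^ 'd ^ 'd"
  shows "Determinant.det (mat_of_vec A) = Determinants.det A"
proof -
  let ?S = "{0..<CARD('d)}"
  let ?f = "map_permutation ?S (idx :: nat \<Rightarrow> 'd)"
  have inj: "inj_on (idx :: nat \<Rightarrow> 'd) ?S" and im: "(idx :: nat \<Rightarrow> 'd) ` ?S = UNIV"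
    using bij_idx[where 'd='d] by (auto simp: bij_betw_def)
  have "?f = (\<lambda>\<pi> x. if x \<in> UNIV then idx (\<pi> (inv_into ?S idx x)) else x)"
    by (auto simp: fun_eq_iff map_permutation_def restrict_id_def im)
  then have bij: "bij_betw ?f {p. p permutes ?S} {p. p permutes UNIV}"
    using bij_betw_permutations[OF bij_idx[where 'd='d]] by simp
  have "Determinants.det A
      = (\<Sum>p | p permutes ?S. of_int (sign (?f p)) * (\<Prod>x\<in>UNIV. A $ x $ ?f p x))"
    unfolding Determinants.det_def by (rule sum.reindex_bij_betw[OF bij, symmetric])
  also have "\<dots> = (\<Sum>p | p permutes ?S. of_int (sign p) * (\<Prod>i\<in>?S. mat_of_vec A $$ (i, p i)))"
  proof (rule sum.cong[OF refl], clarify)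
    fix p assume p: "p permutes ?S"
    have "(\<Prod>x\<in>UNIV. A $ x $ ?f p x) = (\<Prod>i\<in>?S. A $ idx i $ ?f p (idx i))"
      by (rule prod.reindex_bij_betw[OF bij_idx, symmetric])
    also have "\<dots> = (\<Prod>i\<in>?S. mat_of_vec A $$ (i, p i))"
    proof (rule prod.cong[OF refl])
      fix i assume i: "i \<in> ?S"
      then have "p i \<in> ?S" using p by (simp only: permutes_in_image)
      then show "A $ idx i $ ?f p (idx i) = mat_of_vec A $$ (i, p i)"
        using i by (simp add: map_permutation_apply[OF inj])
    qed
    finally show "of_int (sign (?f p)) * (\<Prod>x\<in>UNIV. A $ x $ ?f p x)
        = of_int (sign p) * (\<Prod>i\<in>?S. mat_of_vec A $$ (i, p i))"
      using sign_map_permutation[OF inj p] by simp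
  qed
  also have "\<dots> = Determinant.det (mat_of_vec A)"
    by (rule det_def'[OF mat_of_vec_carrier, symmetric])
  finally show ?thesis by simp
qed

text \<open>The weights \<epsilon> are all put into the left factor \<open>?B\<close> of the update,
  so they scale the columns of the small matrix, which need not be symmetric.\<close>

lemma det_add_sum_outer:
  fixes X :: "real ^ 'd ^ 'd" and w :: "nat \<Rightarrow> real ^ 'd"
  assumes "invertible X"
  shows "Determinants.det (X + (\<Sum>l<m. \<epsilon> l *\<^sub>R outer (w l))) = Determinants.det X *
    Determinant.det (mat m m (\<lambda>(p,q). (if p = q then 1 else 0) + \<epsilon> q * (w p \<bullet> (matrix_inv X *v w q))))"
proof -
  let ?d = "CARD('d)"
  let ?B = "mat ?d m (\<lambda>(i,l). \<epsilon> l * w l $ idx i)"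
  let ?C = "mat m ?d (\<lambda>(l,i). w l $ idx i)"
  let ?Y = "mat_of_vec (matrix_inv X)"
  have "?Y * mat_of_vec X = 1\<^sub>m ?d"
    using assms by (simp add: mat_of_vec_mult[symmetric] mat_of_vec_one matrix_inv_mult(2))
  then have "Determinant.det (mat_of_vec X + ?B * ?C)
      = Determinant.det (mat_of_vec X) * Determinant.det (1\<^sub>m m + ?C * (?Y * ?B))"
    by (intro det_add_mult) auto
  moreover have "mat_of_vec X + ?B * ?C = mat_of_vec (X + (\<Sum>l<m. \<epsilon> l *\<^sub>R outer (w l)))"
    by (rule eq_matI) (auto simp: scalar_prod_def outer_def atLeast0LessThan mat_of_vec_def mult.assoc)
  moreover have "1\<^sub>m m + ?C * (?Y * ?B)
      = mat m m (\<lambda>(p,q). (if p = q then 1 else 0) + \<epsilon> q * (w p \<bullet> (matrix_inv X *v w q)))"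
    by (rule eq_matI)
      (auto simp: scalar_prod_def atLeast0LessThan inner_vec_def matrix_vector_mult_def sum_idx[symmetric]
        sum_distrib_left mult_ac mat_of_vec_def)
  ultimately show ?thesis
    by (simp add: det_mat_of_vec)
qed

lemma det_mat_2:
  "Determinant.det (mat 2 2 f) = f (0,0) * f (1,1) - f (0,1) * (f (1,0) :: 'a::comm_ring_1)"
proof -
  have "Determinant.det (mat 2 2 f) = (\<Sum>j<2. mat 2 2 f $$ (0,j) * cofactor (mat 2 2 f) 0 j)"
    by (rule laplace_expansion_row) auto
  also have "\<dots> = f (0,0) * cofactor (mat 2 2 f) 0 0 + f (0,1) * cofactor (mat 2 2 f) 0 1"
    by (simp add: numeral_2_eq_2)
  also have "cofactor (mat 2 2 f) 0 0 = f (1,1)"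
    unfolding cofactor_def by (subst det_single) (auto simp: mat_delete_def)
  also have "cofactor (mat 2 2 f) 0 1 = - f (1,0)"
    unfolding cofactor_def by (subst det_single) (auto simp: mat_delete_def)
  finally show ?thesis by simp
qed

section \<open>A determinant bound from two-by-two minors\<close>

lemma det_scale_rows_cols:
  "Determinant.det (mat n n (\<lambda>(i,j). e i * e j * h i j))
    = (\<Prod>i<n. e i)\<^sup>2 * (Determinant.det (mat n n (\<lambda>(i,j). h i j)) :: 'a::comm_ring_1)"
proof -
  have "(\<Prod>i=0..<n. e i * e (p i) * h i (p i)) = (\<Prod>i<n. e i)\<^sup>2 * (\<Prod>i=0..<n. h i (p i))"
    if "p permutes {0..<n}" for p
    using prod.permute[OF that, of e]
    by (simp add: prod.distrib power2_eq_square atLeast0LessThan o_def)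
  then show ?thesis
    by (subst (1 2) det_def'[of _ n])
      (auto simp: sum_distrib_left permutes_in_image mult_ac intro!: sum.cong)
qed

text \<open>Conjugating with \<open>e\<close> keeps the determinant and the hypotheses but makes the diagonal sums of the
  two blocks equal. With the sign \<open>s\<close> distinguishing the blocks, every squared entry is then at most
  \<open>s i * b i * (s j * b j)\<close>, plus \<open>1\<close> off the diagonal blocks, and the first terms sum to \<open>0\<close>.\<close>

lemma det_le_power_of_minors_le_1:
  fixes h :: "nat \<Rightarrow> nat \<Rightarrow> real"
  assumes k: "0 < k"
    and pos: "\<And>i. i < 2 * k \<Longrightarrow> 0 < h i i"
    and same: "\<And>i j. i < 2 * k \<Longrightarrow> j < 2 * k \<Longrightarrow> (i < k \<longleftrightarrow> j < k) \<Longrightarrow> (h i j)\<^sup>2 \<le> h i i * h j j"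
    and opp: "\<And>i j. i < 2 * k \<Longrightarrow> j < 2 * k \<Longrightarrow> (i < k \<longleftrightarrow> \<not> j < k) \<Longrightarrow> h i i * h j j + (h i j)\<^sup>2 \<le> 1"
  shows "Determinant.det (mat (2 * k) (2 * k) (\<lambda>(i,j). h i j)) \<le> real k ^ k"
proof -
  let ?D = "Determinant.det (mat (2 * k) (2 * k) (\<lambda>(i,j). h i j))"
  define A B where "A = (\<Sum>i<k. h i i)" and "B = (\<Sum>i=k..<2*k. h i i)"
  have A: "0 < A" unfolding A_def using k pos by (intro sum_pos) auto
  have B: "0 < B" unfolding B_def using k pos by (intro sum_pos) auto
  have split: "(\<Sum>i<2*k. f i) = (\<Sum>i<k. f i) + (\<Sum>i=k..<2*k. f i)" for f :: "nat \<Rightarrow> real"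
    by (simp add: atLeast0LessThan[symmetric] sum.atLeastLessThan_concat)
  \<comment> \<open>This \<tau> solves \<open>\<tau> * A = B / \<tau>\<close>, which equalises the
    two block sums. The scaling \<open>e\<close> has square \<tau> on the first block and its
    inverse on the second, so its product over all indices is 1.\<close>
  define \<tau> where "\<tau> = sqrt (B / A)"
  have \<tau>: "0 < \<tau>" "\<tau>\<^sup>2 = B / A" unfolding \<tau>_def using A B by auto
  define e where "e i = (if i < k then sqrt \<tau> else 1 / sqrt \<tau>)" for i
  have e: "0 < e i" for i using \<tau> by (simp add: e_def)
  have e2: "(e i)\<^sup>2 = (if i < k then \<tau> else 1 / \<tau>)" for i
    using \<tau> by (simp add: e_def power_divide)
  define b where "b i = (e i)\<^sup>2 * h i i" for i
  define s where "s i = (if i < k then 1 else -1 :: real)" for i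
  have "(\<Sum>i<k. b i) = \<tau> * A" "(\<Sum>i=k..<2*k. b i) = B / \<tau>"
    by (simp_all add: b_def e2 A_def B_def sum_distrib_left sum_divide_distrib)
  moreover have "\<tau> * A = B / \<tau>"
    using \<tau> A by (simp add: field_simps power2_eq_square)
  ultimately have balanced: "(\<Sum>i<2*k. s i * b i) = 0"
    by (simp add: split s_def sum_negf)
  \<comment> \<open>The term \<open>(1 - s i * s j) / 2\<close> is 1 if \<open>i\<close> and
    \<open>j\<close> lie in different blocks and 0 otherwise.\<close>
  have bound: "(e i * e j * h i j)\<^sup>2 \<le> (s i * b i) * (s j * b j) + (1 - s i * s j) / 2"
    if ij: "i < 2 * k" "j < 2 * k" for i j
  proof (cases "i < k \<longleftrightarrow> j < k")
    case True
    have "(e i * e j * h i j)\<^sup>2 \<le> ((e i)\<^sup>2 * (e j)\<^sup>2) * (h i i * h j j)"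
      unfolding power_mult_distrib using same[OF ij True] by (intro mult_left_mono) auto
    then show ?thesis using True by (auto simp: s_def b_def algebra_simps)
  next
    case False
    then have "(e i)\<^sup>2 * (e j)\<^sup>2 = 1" using \<tau> by (auto simp: e2)
    moreover have "h i i * h j j + (h i j)\<^sup>2 \<le> 1" using opp[OF ij] False by blast
    moreover have "(s i * b i) * (s j * b j) = - ((e i)\<^sup>2 * (e j)\<^sup>2) * (h i i * h j j)"
      using False by (auto simp: s_def b_def)
    moreover have "s i * s j = -1" using False by (auto simp: s_def)
    ultimately show ?thesis by (simp add: power_mult_distrib)
  qed
  have s0: "(\<Sum>i<2*k. s i) = 0"
    by (simp add: split s_def)
  have "(\<Sum>i<2*k. \<Sum>j<2*k. (e i * e j * h i j)\<^sup>2)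
      \<le> (\<Sum>i<2*k. \<Sum>j<2*k. (s i * b i) * (s j * b j) + (1 - s i * s j) / 2)"
    using bound by (intro sum_mono) auto
  \<comment> \<open>The double sums factor, and both \<open>s\<close> and \<open>s * b\<close> sum
    to zero, so only half the number of entries survives.\<close>
  also have "\<dots> = (\<Sum>i<2*k. s i * b i) * (\<Sum>j<2*k. s j * b j)
      + (real (2*k) * real (2*k) - (\<Sum>i<2*k. s i) * (\<Sum>j<2*k. s j)) / 2"
    by (simp add: sum.distrib sum_subtractf sum_product diff_divide_distrib sum_divide_distrib[symmetric])
  also have "\<dots> = 2 * (real k)\<^sup>2"
    unfolding balanced s0 by (simp add: power2_eq_square)
  finally have frob: "(\<Sum>i<2*k. \<Sum>j<2*k. (e i * e j * h i j)\<^sup>2) / real (2*k) \<le> real k"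
    using k by (simp add: field_simps power2_eq_square)
  have "(\<Prod>i<2*k. e i) = (\<Prod>i<k. e i) * (\<Prod>i=k..<2*k. e i)"
    by (simp add: atLeast0LessThan[symmetric] prod.atLeastLessThan_concat)
  also have "\<dots> = 1"
    using \<tau> by (simp add: e_def power_divide)
  finally have "?D = Determinant.det (mat (2*k) (2*k) (\<lambda>(i,j). e i * e j * h i j))"
    by (simp add: det_scale_rows_cols)
  then have "?D\<^sup>2 \<le> ((\<Sum>i<2*k. \<Sum>j<2*k. (e i * e j * h i j)\<^sup>2) / real (2*k)) ^ (2*k)"
    using det_square_le_frobenius[of "mat (2*k) (2*k) (\<lambda>(i,j). e i * e j * h i j)" "2*k"] by simp
  also have "\<dots> \<le> real k ^ (2*k)"
    by (intro power_mono[OF frob]) (simp add: sum_nonneg)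
  also have "\<dots> = (real k ^ k)\<^sup>2"
    by (simp add: power_mult[symmetric] mult.commute)
  finally show ?thesis
    by (rule power2_le_imp_le) simp
qed

section \<open>Symmetric positive definite matrices\<close>

lemma outer_mult_vec: "outer v *v x = (v \<bullet> x) *\<^sub>R v"
  by (simp add: Finite_Cartesian_Product.vec_eq_iff outer_def matrix_vector_mult_def inner_vec_def
      sum_distrib_left mult_ac)

lemma inner_add_sum_outer:
  "x \<bullet> ((C + (\<Sum>i\<in>S. outer (a i))) *v y) = x \<bullet> (C *v y) + (\<Sum>i\<in>S. (a i \<bullet> x) * (a i \<bullet> y))"
proof (induction S rule: infinite_finite_induct)
  case (insert i S)
  then show ?case
    by (simp add: matrix_vector_mult_add_rdistrib inner_add_right outer_mult_vec inner_commute[of x "a i"])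
qed simp_all

lemma transpose_add_sum_outer:
  "transpose C = C \<Longrightarrow> transpose (C + (\<Sum>i\<in>S. outer (a i))) = C + (\<Sum>i\<in>S. outer (a i))"
  by (simp add: Finite_Cartesian_Product.vec_eq_iff transpose_def outer_def mult.commute)

lemma sym_pos_def_add_sum_outer:
  assumes "sym_pos_def C"
  shows "sym_pos_def (C + (\<Sum>i\<in>S. outer (a i)))"
  using assms
  by (auto simp: sym_pos_def_def transpose_add_sum_outer inner_add_sum_outer
      intro!: add_pos_nonneg sum_nonneg)

lemma sym_pos_def_pos: "sym_pos_def A \<Longrightarrow> x \<noteq> 0 \<Longrightarrow> 0 < x \<bullet> (A *v x)"
  by (simp add: sym_pos_def_def)

lemma sym_pos_def_nonneg: "sym_pos_def A \<Longrightarrow> 0 \<le> x \<bullet> (A *v x)"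
  by (cases "x = 0") (auto dest: sym_pos_def_pos[of A x])

lemma sym_pos_def_commute: "sym_pos_def A \<Longrightarrow> x \<bullet> (A *v y) = y \<bullet> (A *v x)"
  by (metis dot_lmul_matrix inner_commute sym_pos_def_def transpose_matrix_vector)

lemma sym_pos_def_invertible: "sym_pos_def A \<Longrightarrow> invertible A"
  by (metis inner_zero_right invertible_left_inverse less_irrefl matrix_left_invertible_ker sym_pos_def_pos)

lemma sym_pos_def_inv_vec:
  assumes "sym_pos_def A"
  shows "A *v (matrix_inv A *v x) = x"
  using matrix_inv_mult(1)[OF sym_pos_def_invertible[OF assms]]
  by (simp add: matrix_vector_mul_assoc)

lemma sym_pos_def_Cauchy_Schwarz:
  assumes A: "sym_pos_def A"
  shows "(x \<bullet> (A *v y))\<^sup>2 \<le> (x \<bullet> (A *v x)) * (y \<bullet> (A *v y))"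
proof (cases "y = 0")
  case False
  define c where "c = y \<bullet> (A *v y)"
  define b where "b = x \<bullet> (A *v y)"
  have c: "0 < c" unfolding c_def by (rule sym_pos_def_pos[OF A False])
  have "0 \<le> (x - (b / c) *\<^sub>R y) \<bullet> (A *v (x - (b / c) *\<^sub>R y))"
    by (rule sym_pos_def_nonneg[OF A])
  also have "\<dots> = x \<bullet> (A *v x) - b\<^sup>2 / c"
    using c sym_pos_def_commute[OF A, of y x]
    by (simp add: matrix_vector_mult_diff_distrib matrix_vector_mult_scaleR inner_diff_left
        inner_diff_right b_def[symmetric] c_def[symmetric] power2_eq_square)
  finally show ?thesis
    using c by (simp add: b_def[symmetric] c_def[symmetric] field_simps)
qed simp

text \<open>Cauchy-Schwarz for \<open>A\<close> at \<open>y\<close> and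
  \<open>matrix_inv A *v x\<close>, since \<open>A\<close> maps the latter to
  \<open>x\<close>.\<close>

lemma sym_pos_def_dual_Cauchy_Schwarz:
  assumes A: "sym_pos_def A"
  shows "(x \<bullet> y)\<^sup>2 \<le> (x \<bullet> (matrix_inv A *v x)) * (y \<bullet> (A *v y))"
  using sym_pos_def_Cauchy_Schwarz[OF A, of y "matrix_inv A *v x"]
  by (simp add: sym_pos_def_inv_vec[OF A] inner_commute mult.commute)

lemma sym_pos_def_matrix_inv:
  assumes A: "sym_pos_def A"
  shows "sym_pos_def (matrix_inv A)"
proof -
  let ?B = "matrix_inv A"
  have "transpose ?B ** A = Finite_Cartesian_Product.mat 1"
    using matrix_inv_mult(1)[OF sym_pos_def_invertible[OF A]] A
    by (metis matrix_transpose_mul sym_pos_def_def transpose_mat)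
  then have "transpose ?B = ?B"
    using matrix_inv_mult(1)[OF sym_pos_def_invertible[OF A]]
    by (metis matrix_mul_assoc matrix_mul_lid matrix_mul_rid)
  moreover have "0 < x \<bullet> (?B *v x)" if "x \<noteq> 0" for x
  proof -
    have "?B *v x \<noteq> 0"
      using sym_pos_def_inv_vec[OF A, of x] that by auto
    from sym_pos_def_pos[OF A this] show ?thesis
      by (simp add: sym_pos_def_inv_vec[OF A] inner_commute)
  qed
  ultimately show ?thesis by (simp add: sym_pos_def_def)
qed

lemma bilin_form_mat_of_vec:
  fixes A :: "real ^ 'd ^ 'd"
  obtains x :: "real ^ 'd" where "bilin_form CARD('d) (mat_of_vec A) y y = x \<bullet> (A *v x)"
    and "\<And>i. i < CARD('d) \<Longrightarrow> x $ idx i = y i"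
proof
  let ?x = "\<chi> j::'d. y (inv_into {0..<CARD('d)} idx j)"
  show x: "?x $ idx i = y i" if "i < CARD('d)" for i
    using bij_betw_inv_into_left[OF bij_idx[where 'd='d]] that by simp
  have "?x \<bullet> (A *v ?x) = (\<Sum>i<CARD('d). ?x $ idx i * (\<Sum>j<CARD('d). A $ idx i $ idx j * ?x $ idx j))"
    unfolding inner_vec_def matrix_vector_mult_def inner_real_def vec_lambda_beta sum_idx[symmetric] by (rule refl)
  also have "\<dots> = (\<Sum>i<CARD('d). y i * (\<Sum>j<CARD('d). A $ idx i $ idx j * y j))"
    by (intro sum.cong refl arg_cong2[of _ _ _ _ "(*)"]) (simp_all only: x lessThan_iff)
  also have "\<dots> = bilin_form CARD('d) (mat_of_vec A) y y"
    by (simp add: bilin_form_def sum_distrib_left mult.assoc)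
  finally show "bilin_form CARD('d) (mat_of_vec A) y y = ?x \<bullet> (A *v ?x)" ..
qed

lemma trace_mat_of_vec:
  fixes A :: "real ^ 'd ^ 'd"
  shows "(\<Sum>i<CARD('d). mat_of_vec A $$ (i,i)) = trace A"
  by (simp add: trace_def sum_idx[symmetric])

lemma
  fixes X Y :: "real ^ 'd ^ 'd"
  assumes X: "sym_pos_def X" and Y: "sym_pos_def Y"
  shows sym_pos_def_det_ratio_nonneg: "0 \<le> Determinants.det (matrix_inv X ** Y)"
    and sym_pos_def_trace_ratio_nonneg: "0 \<le> trace (matrix_inv X ** Y)"
    and sym_pos_def_det_ratio_le:
      "Determinants.det (matrix_inv X ** Y) \<le> (trace (matrix_inv X ** Y) / CARD('d)) ^ CARD('d)"
proof -
  let ?d = "CARD('d)"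
  let ?M = "mat_of_vec (matrix_inv X ** Y)"
  \<comment> \<open>The quotient \<open>?M\<close> need not be symmetric, but multiplying it by
    \<open>X\<close> returns \<open>Y\<close>, which is what the pencil requires.\<close>
  have XM: "mat_of_vec X * ?M = mat_of_vec Y"
    using matrix_inv_mult(1)[OF sym_pos_def_invertible[OF X]]
    by (simp add: mat_of_vec_mult[symmetric] matrix_mul_assoc)
  have sym: "A $ i $ j = A $ j $ i" if A: "sym_pos_def A" for A :: "real ^ 'd ^ 'd" and i j
  proof -
    have "A $ i $ j = transpose A $ i $ j" using A by (simp add: sym_pos_def_def)
    then show ?thesis by (simp add: transpose_def)
  qed
  interpret symmetric_pencil ?d "mat_of_vec X" ?M
  proof
    fix y :: "nat \<Rightarrow> real"
    show "0 < bilin_form ?d (mat_of_vec X) y y" if "\<exists>i<?d. y i \<noteq> 0"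
    proof -
      obtain x where x: "bilin_form ?d (mat_of_vec X) y y = x \<bullet> (X *v x)"
        "\<And>i. i < ?d \<Longrightarrow> x $ idx i = y i"
        using bilin_form_mat_of_vec[of X y] by blast
      then have "x \<noteq> 0" using that by force
      then show ?thesis using x(1) sym_pos_def_pos[OF X] by simp
    qed
    show "0 \<le> bilin_form ?d (mat_of_vec X * ?M) y y"
      unfolding XM using bilin_form_mat_of_vec[of Y y] sym_pos_def_nonneg[OF Y] by metis
  qed (use sym[OF X] sym[OF Y] in \<open>simp_all add: XM\<close>)
  show "0 \<le> Determinants.det (matrix_inv X ** Y)"
    using det_nonneg by (simp add: det_mat_of_vec)
  show "0 \<le> trace (matrix_inv X ** Y)"
    using diag_sum_nonneg unfolding trace_mat_of_vec .
  show "Determinants.det (matrix_inv X ** Y) \<le> (trace (matrix_inv X ** Y) / ?d) ^ ?d"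
    using det_le_mean_diag_power unfolding det_mat_of_vec trace_mat_of_vec .
qed

lemma matrix_inv_mat_1: "matrix_inv (Finite_Cartesian_Product.mat 1 :: real ^ 'd ^ 'd) = Finite_Cartesian_Product.mat 1"
  using matrix_inv_mult(1)[of "Finite_Cartesian_Product.mat 1 :: real ^ 'd ^ 'd"]
  by (simp add: invertible_def matrix_mul_lid)

text \<open>Comparison with the identity matrix gives nonnegativity; invertibility excludes
  zero.\<close>

lemma sym_pos_def_det_pos:
  assumes A: "sym_pos_def A"
  shows "0 < Determinants.det A"
proof -
  have "sym_pos_def (Finite_Cartesian_Product.mat 1 :: real ^ 'd ^ 'd)"
    by (simp add: sym_pos_def_def)
  from sym_pos_def_det_ratio_nonneg[OF this A] have "0 \<le> Determinants.det A"
    by (simp add: matrix_inv_mat_1)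
  moreover have "Determinants.det A \<noteq> 0"
    using sym_pos_def_invertible[OF A] by (simp add: invertible_det_nz)
  ultimately show ?thesis by simp
qed

lemma sym_pos_def_det_le_trace:
  fixes X Y :: "real ^ 'd ^ 'd"
  assumes X: "sym_pos_def X" and Y: "sym_pos_def Y"
  shows "Determinants.det Y \<le> Determinants.det X * (trace (matrix_inv X ** Y) / CARD('d)) ^ CARD('d)"
proof -
  have "Determinants.det X * Determinants.det (matrix_inv X ** Y) = Determinants.det (X ** (matrix_inv X ** Y))"
    by (simp add: Determinants.det_mul)
  also have "X ** (matrix_inv X ** Y) = Y"
    using matrix_inv_mult(1)[OF sym_pos_def_invertible[OF X]] by (simp add: matrix_mul_assoc)
  finally show ?thesis
    using mult_left_mono[OF sym_pos_def_det_ratio_le[OF X Y], of "Determinants.det X"] sym_pos_def_det_pos[OF X]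
    by simp
qed

lemma trace_mult_outer: "trace (A ** outer w) = w \<bullet> (A *v w)"
  by (simp add: trace_def matrix_matrix_mult_def matrix_vector_mult_def outer_def inner_vec_def
      sum_distrib_left mult_ac)

lemma trace_mult_scaleR: "trace (A ** (c *\<^sub>R B)) = c * trace (A ** B)"
  by (simp add: trace_def matrix_matrix_mult_def sum_distrib_left mult_ac)

lemma trace_mult_add_sum_outer:
  "trace (A ** (X + (\<Sum>l<m. \<epsilon> l *\<^sub>R outer (w l))))
    = trace (A ** X) + (\<Sum>l<(m::nat). \<epsilon> l * (w l \<bullet> (A *v w l)))"
  by (induction m)
    (simp_all add: matrix_add_ldistrib trace_add trace_mult_outer trace_mult_scaleR add.assoc[symmetric])

section \<open>Exchanging selected points\<close>

lemma sum_lessThan_double: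
  fixes f :: "nat \<Rightarrow> 'a::comm_monoid_add"
  shows "(\<Sum>l<2*k. f l) = (\<Sum>l<k. f l) + (\<Sum>l<k. f (l + k))"
proof -
  have "(\<Sum>l<2*k. f l) = (\<Sum>l=0..<k. f l) + (\<Sum>l=k..<2*k. f l)"
    by (simp add: atLeast0LessThan[symmetric] sum.atLeastLessThan_concat)
  also have "(\<Sum>l=k..<2*k. f l) = (\<Sum>l=0..<k. f (l + k))"
    using sum.shift_bounds_nat_ivl[of f 0 k k] by (simp add: mult_2)
  finally show ?thesis by (simp add: atLeast0LessThan)
qed

locale selection =
  fixes C :: "real ^ 'd ^ 'd" and a :: "nat \<Rightarrow> real ^ 'd" and S :: "nat set"
  assumes C: "sym_pos_def C" and finite_S: "finite S"
begin

definition X :: "real ^ 'd ^ 'd" where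
  "X = C + (\<Sum>i\<in>S. outer (a i))"

definition r :: "nat \<Rightarrow> nat \<Rightarrow> real" where
  "r i j = a i \<bullet> (matrix_inv X *v a j)"

lemma X_pos_def: "sym_pos_def X"
  unfolding X_def by (rule sym_pos_def_add_sum_outer[OF C])

lemma det_X: "Determinants.det X = info_det C a S"
  by (simp add: X_def info_det_def)

lemma r_commute: "r i j = r j i"
  unfolding r_def by (rule sym_pos_def_commute[OF sym_pos_def_matrix_inv[OF X_pos_def]])

lemma r_nonneg: "0 \<le> r i i"
  unfolding r_def by (rule sym_pos_def_nonneg[OF sym_pos_def_matrix_inv[OF X_pos_def]])

lemma r_Cauchy_Schwarz: "(r i j)\<^sup>2 \<le> r i i * r j j"
  unfolding r_def by (rule sym_pos_def_Cauchy_Schwarz[OF sym_pos_def_matrix_inv[OF X_pos_def]])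

text \<open>Splits the squared \<open>X\<close>-norm of \<open>q\<close> into the part from
  \<open>C\<close> and one square per selected point. Dropping some of these terms yields the bounds
  on \<open>r\<close> below.\<close>

lemma r_eq_quadratic:
  assumes "q = matrix_inv X *v a i"
  shows "r i i = q \<bullet> (C *v q) + (\<Sum>l\<in>S. (a l \<bullet> q)\<^sup>2)"
proof -
  have "r i i = q \<bullet> (X *v q)"
    by (simp add: assms r_def sym_pos_def_inv_vec[OF X_pos_def] inner_commute)
  then show ?thesis
    by (simp add: X_def inner_add_sum_outer power2_eq_square)
qed

lemma sigma_nonneg: "0 \<le> a i \<bullet> (matrix_inv C *v a i)"
  by (rule sym_pos_def_nonneg[OF sym_pos_def_matrix_inv[OF C]])

text \<open>\<open>X\<close> dominates \<open>C\<close>, so the inverses compare the other way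
  round. Dual Cauchy-Schwarz for \<open>C\<close> bounds the square of
  \<open>r i i = a i \<bullet> q\<close> by \<sigma> times the \<open>C\<close>-part of
  \<open>r i i\<close>.\<close>

lemma r_le_sigma: "r i i \<le> a i \<bullet> (matrix_inv C *v a i)"
proof (cases "r i i = 0")
  case True
  then show ?thesis
    using sigma_nonneg by simp
next
  case False
  let ?\<sigma> = "a i \<bullet> (matrix_inv C *v a i)"
  define q where "q = matrix_inv X *v a i"
  have "(r i i)\<^sup>2 \<le> ?\<sigma> * (q \<bullet> (C *v q))"
    using sym_pos_def_dual_Cauchy_Schwarz[OF C, of "a i" q] by (simp add: q_def r_def)
  also have "\<dots> \<le> ?\<sigma> * r i i"
    using r_eq_quadratic[OF q_def] sigma_nonneg
    by (intro mult_left_mono) (auto simp: sum_nonneg)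
  finally show ?thesis
    using False r_nonneg[of i] by (simp add: power2_eq_square)
qed

text \<open>Sharper because \<open>X\<close> contains the outer product of \<open>a i\<close>
  itself: the term \<open>l = i\<close> of the quadratic sum is the square of \<open>r i i\<close>,
  leaving at most \<open>r i i - (r i i)\<^sup>2\<close> for the \<open>C\<close>-part.\<close>

lemma r_selected_le_sigma:
  assumes "i \<in> S"
  defines "\<sigma> \<equiv> a i \<bullet> (matrix_inv C *v a i)"
  shows "r i i * (1 + \<sigma>) \<le> \<sigma>"
proof (cases "r i i = 0")
  case True
  then show ?thesis
    unfolding \<sigma>_def using sigma_nonneg by simp
next
  case False
  define q where "q = matrix_inv X *v a i"
  have "(r i i)\<^sup>2 \<le> (\<Sum>l\<in>S. (a l \<bullet> q)\<^sup>2)"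
    using member_le_sum[of i S "\<lambda>l. (a l \<bullet> q)\<^sup>2"] assms finite_S by (simp add: q_def r_def)
  then have *: "q \<bullet> (C *v q) \<le> r i i - (r i i)\<^sup>2"
    using r_eq_quadratic[OF q_def] by simp
  have "(r i i)\<^sup>2 \<le> \<sigma> * (q \<bullet> (C *v q))"
    using sym_pos_def_dual_Cauchy_Schwarz[OF C, of "a i" q] by (simp add: q_def r_def \<sigma>_def)
  also have "\<dots> \<le> \<sigma> * (r i i - (r i i)\<^sup>2)"
    unfolding \<sigma>_def using sigma_nonneg * by (intro mult_left_mono) auto
  finally have "r i i * (r i i * (1 + \<sigma>)) \<le> r i i * \<sigma>"
    by (simp add: power2_eq_square algebra_simps)
  then show ?thesis
    using False r_nonneg[of i] by simp
qed

lemma r_selected_less_1: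
  assumes "i \<in> S"
  shows "r i i < 1"
proof (rule ccontr)
  let ?\<sigma> = "a i \<bullet> (matrix_inv C *v a i)"
  have \<sigma>: "0 \<le> ?\<sigma>" by (rule sigma_nonneg)
  assume "\<not> r i i < 1"
  then have "1 * (1 + ?\<sigma>) \<le> r i i * (1 + ?\<sigma>)"
    using \<sigma> by (intro mult_right_mono) auto
  then show False using r_selected_le_sigma[OF assms] by simp
qed

text \<open>The Gram matrix of two selected points is dominated by the identity, because
  \<open>X\<close> dominates the sum of their outer products. Here \<open>Q\<close> is the squared
  \<open>X\<close>-norm of \<open>q\<close>, and the planar Cauchy-Schwarz inequality gives
  \<open>Q * Q \<le> (t\<^sup>2 + u\<^sup>2) * Q\<close>.\<close>

lemma r_selected_quadratic_le:
  assumes ij: "i \<in> S" "j \<in> S" "i \<noteq> j"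
  shows "t\<^sup>2 * r i i + 2 * t * u * r i j + u\<^sup>2 * r j j \<le> t\<^sup>2 + u\<^sup>2"
proof -
  define q where "q = matrix_inv X *v (t *\<^sub>R a i + u *\<^sub>R a j)"
  define Q where "Q = t * (a i \<bullet> q) + u * (a j \<bullet> q)"
  have Xq: "X *v q = t *\<^sub>R a i + u *\<^sub>R a j"
    by (simp add: q_def sym_pos_def_inv_vec[OF X_pos_def])
  have "Q = q \<bullet> (X *v q)"
    by (simp add: Xq Q_def inner_add_right inner_commute)
  also have "\<dots> \<ge> (\<Sum>l\<in>{i,j}. (a l \<bullet> q)\<^sup>2)"
    using ij finite_S sum_mono2[of S "{i,j}" "\<lambda>l. (a l \<bullet> q)\<^sup>2"] sym_pos_def_nonneg[OF C, of q]
    by (auto simp: X_def inner_add_sum_outer power2_eq_square[symmetric])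
  finally have Q_ge: "(a i \<bullet> q)\<^sup>2 + (a j \<bullet> q)\<^sup>2 \<le> Q"
    using ij by simp
  have "Q\<^sup>2 \<le> (t\<^sup>2 + u\<^sup>2) * ((a i \<bullet> q)\<^sup>2 + (a j \<bullet> q)\<^sup>2)"
    using sum_squares_ge_zero[of 0 "t * (a j \<bullet> q) - u * (a i \<bullet> q)"]
    by (simp add: Q_def power2_eq_square algebra_simps)
  also have "\<dots> \<le> (t\<^sup>2 + u\<^sup>2) * Q"
    using Q_ge by (intro mult_left_mono) auto
  finally have "Q * Q \<le> (t\<^sup>2 + u\<^sup>2) * Q"
    by (simp add: power2_eq_square)
  moreover have "0 \<le> Q"
    using Q_ge by (meson add_nonneg_nonneg order_trans zero_le_power2)
  ultimately have "Q \<le> t\<^sup>2 + u\<^sup>2"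
    by (cases "Q = 0") auto
  moreover have "Q = t\<^sup>2 * r i i + 2 * t * u * r i j + u\<^sup>2 * r j j"
    using r_commute[of i j]
    by (simp add: Q_def q_def r_def matrix_vector_right_distrib matrix_vector_mult_scaleR
        inner_add_right power2_eq_square algebra_simps)
  ultimately show ?thesis by simp
qed

lemma r_selected_Cauchy_Schwarz:
  assumes ij: "i \<in> S" "j \<in> S" "i \<noteq> j"
  shows "(r i j)\<^sup>2 \<le> (1 - r i i) * (1 - r j j)"
proof -
  \<comment> \<open>With these coefficients the nonnegative form, identity minus Gram matrix, equals
    its determinant times \<open>1 - r j j\<close>.\<close>
  have "0 \<le> (1 - r j j) * ((1 - r i i) * (1 - r j j) - (r i j)\<^sup>2)"
    using r_selected_quadratic_le[OF ij, of "1 - r j j" "r i j"]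
    by (simp add: power2_eq_square algebra_simps)
  then show ?thesis
    using r_selected_less_1[OF ij(2)] by (simp add: zero_le_mult_iff)
qed

end

locale exchange = selection C a S
  for C :: "real ^ 'd ^ 'd" and a :: "nat \<Rightarrow> real ^ 'd" and S :: "nat set" +
  fixes u v :: "nat \<Rightarrow> nat" and k :: nat
  assumes u: "inj_on u {..<k}" "u ` {..<k} \<subseteq> S"
    and v: "inj_on v {..<k}" "v ` {..<k} \<inter> S = {}"
begin

definition T :: "nat set" where
  "T = (S - u ` {..<k}) \<union> v ` {..<k}"

definition pt :: "nat \<Rightarrow> nat" where
  "pt l = (if l < k then u l else v (l - k))"

definition \<epsilon> :: "nat \<Rightarrow> real" where
  "\<epsilon> l = (if l < k then -1 else 1)"

text \<open>The sign follows the column, so the two mixed blocks are negative transposes of each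
  other; this is why the squared mixed entry enters the swap formula with a plus sign.\<close>

definition h :: "nat \<Rightarrow> nat \<Rightarrow> real" where
  "h p q = (if p = q then 1 else 0) + \<epsilon> q * r (pt p) (pt q)"

lemma exchange_matrix:
  "C + (\<Sum>i\<in>T. outer (a i)) = X + (\<Sum>l<2*k. \<epsilon> l *\<^sub>R outer (a (pt l)))"
proof -
  have "(\<Sum>i\<in>T. outer (a i)) = (\<Sum>i\<in>S - u ` {..<k}. outer (a i)) + (\<Sum>i\<in>v ` {..<k}. outer (a i))"
    unfolding T_def using v finite_S by (intro sum.union_disjoint) auto
  also have "(\<Sum>i\<in>S - u ` {..<k}. outer (a i)) = (\<Sum>i\<in>S. outer (a i)) - (\<Sum>i\<in>u ` {..<k}. outer (a i))"
    using u finite_S by (intro sum_diff) auto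
  finally show ?thesis
    using u(1) v(1)
    by (simp add: X_def sum_lessThan_double \<epsilon>_def pt_def sum.reindex o_def sum_negf)
qed

lemma info_det_exchange:
  "info_det C a T = info_det C a S * Determinant.det (mat (2*k) (2*k) (\<lambda>(p,q). h p q))"
  using det_add_sum_outer[OF sym_pos_def_invertible[OF X_pos_def],
      where m = "2*k" and \<epsilon> = \<epsilon> and w = "\<lambda>l. a (pt l)"]
  by (simp add: info_det_def exchange_matrix h_def r_def X_def[symmetric])

lemma info_det_exchange_le_trace:
  fixes b :: real
  assumes "\<And>l. l < k \<Longrightarrow> r (v l) (v l) - r (u l) (u l) \<le> b"
  shows "info_det C a T \<le> info_det C a S * (1 + real k * b / CARD('d)) ^ CARD('d)"
proof -
  let ?Y = "C + (\<Sum>i\<in>T. outer (a i))"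
  have Y: "sym_pos_def ?Y" by (rule sym_pos_def_add_sum_outer[OF C])
  have "trace (matrix_inv X ** ?Y) = CARD('d) + (\<Sum>l<k. r (v l) (v l) - r (u l) (u l))"
    unfolding exchange_matrix trace_mult_add_sum_outer
    using matrix_inv_mult(2)[OF sym_pos_def_invertible[OF X_pos_def]]
    by (simp add: trace_I sum_lessThan_double \<epsilon>_def pt_def r_def sum_negf sum_subtractf)
  also have "\<dots> \<le> CARD('d) + real k * b"
    using sum_bounded_above[of "{..<k}" "\<lambda>l. r (v l) (v l) - r (u l) (u l)" b] assms by simp
  finally have "trace (matrix_inv X ** ?Y) / CARD('d) \<le> 1 + real k * b / CARD('d)"
    by (simp add: field_simps)
  \<comment> \<open>Monotonicity of the power rests on the nonnegative trace, as \<open>b\<close>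
    may have any sign.\<close>
  then have "(trace (matrix_inv X ** ?Y) / CARD('d)) ^ CARD('d) \<le> (1 + real k * b / CARD('d)) ^ CARD('d)"
    using sym_pos_def_trace_ratio_nonneg[OF X_pos_def Y] by (intro power_mono) auto
  then show ?thesis
    using sym_pos_def_det_le_trace[OF X_pos_def Y] sym_pos_def_det_pos[OF X_pos_def]
    unfolding info_det_def X_def[symmetric]
    by (meson less_imp_le mult_left_mono order_trans)
qed

text \<open>Checks the minor conditions blockwise: removed pairs by
  \<open>r_selected_Cauchy_Schwarz\<close>, inserted pairs by \<open>r_Cauchy_Schwarz\<close> with
  enlarged diagonal, mixed pairs by \<open>swap\<close>.\<close>

lemma info_det_exchange_le_power:
  assumes "0 < k"
    and swap: "\<And>i j. i < k \<Longrightarrow> j < k \<Longrightarrow>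
      (1 - r (u i) (u i)) * (1 + r (v j) (v j)) + (r (u i) (v j))\<^sup>2 \<le> 1"
  shows "info_det C a T \<le> info_det C a S * real k ^ k"
proof -
  have uS: "u l \<in> S" if "l < k" for l
    using u(2) that by auto
  have "Determinant.det (mat (2*k) (2*k) (\<lambda>(p,q). h p q)) \<le> real k ^ k"
  proof (rule det_le_power_of_minors_le_1[OF \<open>0 < k\<close>])
    fix p assume "p < 2 * k"
    then show "0 < h p p"
      using r_selected_less_1[OF uS, of p] r_nonneg[of "v (p - k)"]
      by (auto simp: h_def \<epsilon>_def pt_def)
  next
    fix p q assume pq: "p < 2 * k" "q < 2 * k" "p < k \<longleftrightarrow> q < k"
    show "(h p q)\<^sup>2 \<le> h p p * h q q"
    proof (cases "p = q")
      case False
      show ?thesis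
      proof (cases "p < k")
        case True
        then have "u p \<noteq> u q" using u(1) False pq by (auto simp: inj_on_def)
        then show ?thesis
          using r_selected_Cauchy_Schwarz[OF uS uS, of p q] True pq False
          by (simp add: h_def \<epsilon>_def pt_def)
      next
        case False': False
        let ?i = "v (p - k)" and ?j = "v (q - k)"
        have "(r ?i ?j)\<^sup>2 \<le> r ?i ?i * r ?j ?j" by (rule r_Cauchy_Schwarz)
        also have "\<dots> \<le> (1 + r ?i ?i) * (1 + r ?j ?j)"
          using r_nonneg by (intro mult_mono) auto
        finally show ?thesis
          using False False' pq by (simp add: h_def \<epsilon>_def pt_def)
      qed
    qed (simp add: power2_eq_square)
  next
    fix p q assume pq: "p < 2 * k" "q < 2 * k" "p < k \<longleftrightarrow> \<not> q < k"
    show "h p p * h q q + (h p q)\<^sup>2 \<le> 1"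
    proof (cases "p < k")
      case True
      then show ?thesis
        using swap[of p "q - k"] pq by (auto simp: h_def \<epsilon>_def pt_def)
    next
      case False
      then show ?thesis
        using swap[of q "p - k"] pq r_commute[of "u q" "v (p - k)"]
        by (auto simp: h_def \<epsilon>_def pt_def mult.commute)
    qed
  qed
  then show ?thesis
    unfolding info_det_exchange
    using sym_pos_def_det_pos[OF X_pos_def] by (simp add: det_X)
qed

end

lemma (in selection) info_det_swap:
  assumes "i \<in> S" "j \<notin> S"
  shows "info_det C a ((S \<union> {j}) - {i})
    = info_det C a S * ((1 - r i i) * (1 + r j j) + (r i j)\<^sup>2)"
proof -
  interpret exchange C a S "\<lambda>_. i" "\<lambda>_. j" "Suc 0"
    using assms by unfold_locales (auto simp: inj_on_def)
  have "T = (S \<union> {j}) - {i}"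
    unfolding T_def using assms by auto
  then show ?thesis
    using info_det_exchange r_commute[of i j]
    by (simp add: det_mat_2 h_def \<epsilon>_def pt_def power2_eq_square)
qed

section \<open>Consequences of swap optimality\<close>

locale swap_optimal = selection C a S
  for C :: "real ^ 'd ^ 'd" and a :: "nat \<Rightarrow> real ^ 'd" and S N :: "nat set" +
  assumes finite_N: "finite N" and S_sub: "S \<subseteq> N"
    and no_swap: "\<And>i j. i \<in> S \<Longrightarrow> j \<in> N - S \<Longrightarrow>
      info_det C a ((S \<union> {j}) - {i}) \<le> info_det C a S"
begin

lemma swap_le_1:
  assumes "i \<in> S" "j \<in> N - S"
  shows "(1 - r i i) * (1 + r j j) + (r i j)\<^sup>2 \<le> 1"
  using no_swap[OF assms] info_det_swap[of i j] assms sym_pos_def_det_pos[OF X_pos_def]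
  by (simp add: det_X)

lemma r_diff_le:
  assumes ij: "i \<in> S" "j \<in> N - S"
    and \<sigma>: "a i \<bullet> (matrix_inv C *v a i) \<le> \<sigma>" "a j \<bullet> (matrix_inv C *v a j) \<le> \<sigma>"
  shows "r j j - r i i \<le> \<sigma>\<^sup>2 / (1 + \<sigma>)"
proof -
  have \<sigma>0: "0 \<le> \<sigma>" using sigma_nonneg[of i] \<sigma> by simp
  let ?s = "a i \<bullet> (matrix_inv C *v a i)"
  have "r i i * (1 + ?s) \<le> ?s" by (rule r_selected_le_sigma[OF ij(1)])
  \<comment> \<open>Adding this to the previous inequality replaces the point's own value
    \<open>?s\<close> by the uniform bound \<sigma>.\<close>
  moreover have "r i i * (\<sigma> - ?s) \<le> 1 * (\<sigma> - ?s)"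
    using r_selected_less_1[OF ij(1)] \<sigma> by (intro mult_right_mono) auto
  ultimately have "r i i * (1 + \<sigma>) \<le> \<sigma>"
    by (simp add: algebra_simps)
  then have ri: "r i i \<le> \<sigma> / (1 + \<sigma>)"
    using \<sigma>0 by (simp add: pos_le_divide_eq)
  have "r j j - r i i \<le> r i i * r j j - (r i j)\<^sup>2"
    using swap_le_1[OF ij] by (simp add: algebra_simps)
  also have "\<dots> \<le> r i i * r j j" by simp
  also have "\<dots> \<le> \<sigma> / (1 + \<sigma>) * \<sigma>"
    using ri r_le_sigma[of j] \<sigma> \<sigma>0 r_nonneg by (intro mult_mono) auto
  finally show ?thesis by (simp add: power2_eq_square)
qed

text \<open>Every competitor of equal size arises by exchanging \<open>S - T\<close> for
  \<open>T - S\<close>; the two differences have the same size \<open>k\<close>, so they can be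
  enumerated in parallel.\<close>

lemma swap_optimal_bounds:
  assumes T: "T \<subseteq> N" "card T = card S"
    and \<sigma>: "\<And>i. i \<in> N \<Longrightarrow> a i \<bullet> (matrix_inv C *v a i) \<le> \<sigma>"
  defines "k \<equiv> card (S - T)"
  shows "info_det C a T \<le> info_det C a S * (1 + real k * (\<sigma>\<^sup>2 / (1 + \<sigma>)) / CARD('d)) ^ CARD('d)"
    and "info_det C a T \<le> info_det C a S * real k ^ k"
proof -
  have finT: "finite T" using T finite_N by (meson finite_subset)
  have "card (S - T) = card (T - S)"
    using T finT finite_S by (simp add: card_Diff_subset_Int Int_commute)
  then obtain u v where u: "bij_betw u {..<k} (S - T)" and v: "bij_betw v {..<k} (T - S)"
    using finT finite_S unfolding k_def
    by (metis ex_bij_betw_nat_finite finite_Diff atLeast0LessThan)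
  have ranges: "u l \<in> S" "v l \<in> N - S" if "l < k" for l
    using bij_betwE[OF u] bij_betwE[OF v] that T by auto
  interpret E: exchange C a S u v k
    using u v by unfold_locales (auto simp: bij_betw_def)
  have ET: "E.T = T"
    using u v unfolding E.T_def bij_betw_def by auto
  show "info_det C a T \<le> info_det C a S * (1 + real k * (\<sigma>\<^sup>2 / (1 + \<sigma>)) / CARD('d)) ^ CARD('d)"
    using E.info_det_exchange_le_trace[of "\<sigma>\<^sup>2 / (1 + \<sigma>)"] ranges r_diff_le \<sigma> S_sub
    unfolding ET by blast
  show "info_det C a T \<le> info_det C a S * real k ^ k"
  proof (cases "k = 0")
    \<comment> \<open>The exchange bound needs a positive \<open>k\<close>; with nothing exchanged
      the factor is \<open>0 ^ 0 = 1\<close>.\<close>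
    case True
    then have "T = S"
      using u v by (auto simp: bij_betw_def)
    then show ?thesis using True by simp
  next
    case False
    then show ?thesis
      using E.info_det_exchange_le_power swap_le_1 ranges unfolding ET by blast
  qed
qed

end

section \<open>Outputs of the local search and the approximation bound\<close>

lemma local_search_output_subset:
  assumes "local_search_output C a n s S"
  shows "S \<subseteq> {1..n}" "card S = s"
proof -
  obtain S0 where S0: "S0 \<subseteq> {1..n}" "card S0 = s" "(improving_swap C a n)\<^sup>*\<^sup>* S0 S"
    using assms unfolding local_search_output_def by blast
  from S0(3) have "S \<subseteq> {1..n} \<and> card S = s"
  proof induction
    case (step S T)
    then obtain i j where ij: "i \<in> S" "j \<in> {1..n} - S" "T = (S \<union> {j}) - {i}"
      unfolding improving_swap_def by blast
    have "finite S" using step by (meson finite_atLeastAtMost finite_subset)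
    then have "card T = card S"
      using ij by (simp add: card_Diff_singleton card_insert_if)
    then show ?case using ij step by auto
  qed (use S0 in auto)
  then show "S \<subseteq> {1..n}" "card S = s" by auto
qed

theorem theorem12:
  fixes C :: "real ^ 'd ^ 'd" and a :: "nat \<Rightarrow> real ^ 'd" and n s sbar :: nat
    and S :: "nat set" and \<sigma> :: real
  assumes "sym_pos_def C"
    and "0 < s" and "s < n"
    and "local_search_output C a n s S"
  defines "sbar \<equiv> min s (n - s)"
    and "\<sigma> \<equiv> sigma_max C a n"
  shows "ln (info_det C a S) \<ge> opt_value C a n s -
           min (real CARD('d) * ln (1 + real sbar * \<sigma>\<^sup>2 / (real CARD('d) * (1 + \<sigma>))))
               (real sbar * ln (real sbar))"
proof -
  note S = local_search_output_subset[OF assms(4)]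
  have finS: "finite S" using S(1) by (meson finite_atLeastAtMost finite_subset)
  have "info_det C a ((S \<union> {j}) - {i}) \<le> info_det C a S" if "i \<in> S" "j \<in> {1..n} - S" for i j
  proof (rule ccontr)
    assume "\<not> ?thesis"
    then have "improving_swap C a n S ((S \<union> {j}) - {i})"
      unfolding improving_swap_def using that
      by - (rule bexI[where x = i], rule bexI[where x = j], auto simp: not_le)
    then show False using assms(4) unfolding local_search_output_def by blast
  qed
  then interpret swap_optimal C a S "{1..n}"
    using assms(1) S finS by unfold_locales auto
  let ?F = "{T. T \<subseteq> {1..n} \<and> card T = s}"
  have "finite ?F" by simp
  moreover have "S \<in> ?F" using S by simp
  ultimately have "opt_value C a n s \<in> (\<lambda>T. ln (info_det C a T)) ` ?F"
    unfolding opt_value_def by (intro Max_in) auto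
  then obtain T where T: "T \<subseteq> {1..n}" "card T = s" "opt_value C a n s = ln (info_det C a T)"
    by auto
  have \<sigma>: "a i \<bullet> (matrix_inv C *v a i) \<le> \<sigma>" if "i \<in> {1..n}" for i
    unfolding \<sigma>_def sigma_max_def using that by (intro Max_ge) auto
  have \<sigma>0: "0 \<le> \<sigma>" using \<sigma>[of 1] sigma_nonneg[of 1] assms(3) by simp
  define k where "k = card (S - T)"
  have bounds: "info_det C a T \<le> info_det C a S * (1 + real k * (\<sigma>\<^sup>2 / (1 + \<sigma>)) / CARD('d)) ^ CARD('d)"
      "info_det C a T \<le> info_det C a S * real k ^ k"
    using swap_optimal_bounds[OF T(1) _ \<sigma>] T(2) S(2) by (simp_all add: k_def)
  have "k \<le> s" unfolding k_def using S finS card_mono[of S "S - T"] by auto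
  moreover have "k \<le> n - s"
  proof -
    \<comment> \<open>The removed points avoid \<open>T\<close>, so they lie in its complement,
      which has \<open>n - s\<close> elements.\<close>
    have "k \<le> card ({1..n} - T)"
      unfolding k_def using S by (intro card_mono) auto
    also have "\<dots> = n - s"
      using T by (simp add: card_Diff_subset finite_subset[OF T(1)])
    finally show ?thesis .
  qed
  ultimately have k: "k \<le> sbar" by (simp add: sbar_def)
  have sbar: "1 \<le> sbar" using assms(2,3) by (simp add: sbar_def)
  let ?d = "CARD('d)"
  let ?c = "1 + real sbar * \<sigma>\<^sup>2 / (real ?d * (1 + \<sigma>))"
  have pos: "0 < info_det C a R" for R
    unfolding info_det_def by (rule sym_pos_def_det_pos[OF sym_pos_def_add_sum_outer[OF assms(1)]])
  have c: "1 \<le> ?c" using \<sigma>0 by simp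
  have "1 + real k * (\<sigma>\<^sup>2 / (1 + \<sigma>)) / ?d \<le> ?c"
    using k \<sigma>0 by (simp add: divide_right_mono mult_right_mono mult.commute[of "real ?d"])
  then have "(1 + real k * (\<sigma>\<^sup>2 / (1 + \<sigma>)) / ?d) ^ ?d \<le> ?c ^ ?d"
    using \<sigma>0 by (intro power_mono) auto
  then have "info_det C a T \<le> info_det C a S * ?c ^ ?d"
    using order_trans[OF bounds(1) mult_left_mono] pos[of S] by simp
  then have "ln (info_det C a T) \<le> ln (info_det C a S * ?c ^ ?d)"
    using pos by (intro ln_mono) auto
  also have "\<dots> = ln (info_det C a S) + real ?d * ln ?c"
    using pos[of S] c by (simp add: ln_mult ln_realpow)
  finally have 1: "opt_value C a n s - real ?d * ln ?c \<le> ln (info_det C a S)"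
    by (simp add: T(3))
  \<comment> \<open>Enlarging first the base and then the exponent also covers \<open>k = 0\<close>,
    where the left side is 1; the second step uses \<open>1 \<le> sbar\<close>.\<close>
  have "real k ^ k \<le> real sbar ^ sbar"
  proof -
    have "real k ^ k \<le> real sbar ^ k" using k by (intro power_mono) auto
    also have "\<dots> \<le> real sbar ^ sbar" using k sbar by (intro power_increasing) auto
    finally show ?thesis .
  qed
  then have "info_det C a T \<le> info_det C a S * real sbar ^ sbar"
    using order_trans[OF bounds(2) mult_left_mono] pos[of S] by simp
  then have "ln (info_det C a T) \<le> ln (info_det C a S * real sbar ^ sbar)"
    using pos by (intro ln_mono) auto
  also have "\<dots> = ln (info_det C a S) + real sbar * ln (real sbar)"
    using pos[of S] sbar by (simp add: ln_mult ln_realpow)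
  finally have 2: "opt_value C a n s - real sbar * ln (real sbar) \<le> ln (info_det C a S)"
    by (simp add: T(3))
  from 1 2 show ?thesis by (simp add: min_def)
qed

end
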